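(* Let $n\ge 1$, let $k$ be a field, and let $M$ be a squarefree monomial ideal in $S=k[x_1,\ldots,x_n]$. If $\operatorname{pd}(S/M)=n$, then $M=(x_1,\ldots,x_n)$.
   Context: $\operatorname{pd}(S/M)$ is the projective dimension of $S/M$ over $S$. A squarefree monomial ideal is one generated by squarefree monomials. *)

theory Defs
  imports
    "HOL-Algebra.Algebraic_Closure_Type"
    "HOL-Algebra.QuotRing"
    "HOL-Algebra.Module"
    "HOL-Library.Poly_Mapping"
    "HOL-Library.Extended_Nat"
    "HOL-Library.Cardinality"
begin

section \<open>Polynomials and squarefree monomial ideals\<close>

text \<open>
  The variables are indexed by a finite type \<open>'n\<close>, so their number is \<open>n = CARD('n)\<close>;
  \<open>n \<ge> 1\<close> holds because types are nonempty.  An exponent vector has type \<open>'n \<Rightarrow>\<^sub>0 nat\<close>, and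
  the product of \<open>Poly_Mapping\<close> is convolution over the additive monoid of exponent vectors.
\<close>

type_synonym ('n, 'k) mpoly = "('n \<Rightarrow>\<^sub>0 nat) \<Rightarrow>\<^sub>0 'k"

abbreviation mpoly_ring :: "('n::finite, 'k::field) mpoly ring" where
  "mpoly_ring \<equiv> ring_of_type_algebra"

definition monomial :: "('n::finite \<Rightarrow>\<^sub>0 nat) \<Rightarrow> ('n, 'k::field) mpoly" where
  "monomial m = Poly_Mapping.single m 1"

definition variable :: "'n::finite \<Rightarrow> ('n, 'k::field) mpoly" where
  "variable i = monomial (Poly_Mapping.single i 1)"

definition squarefree_monomials :: "('n::finite, 'k::field) mpoly set" where
  "squarefree_monomials = {monomial m |m. \<forall>i. Poly_Mapping.lookup m i \<le> 1}"

text \<open>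
  The empty product \<open>1\<close> is a squarefree monomial and the set of generators may be empty, so the
  unit ideal and the zero ideal are both included.
\<close>

definition squarefree_monomial_ideal :: "('n::finite, 'k::field) mpoly set \<Rightarrow> bool" where
  "squarefree_monomial_ideal I \<longleftrightarrow>
     (\<exists>G \<subseteq> squarefree_monomials. I = Idl\<^bsub>mpoly_ring\<^esub> G)"

section \<open>Projective dimension\<close>

definition mod_hom ::
  "('a, 'r) ring_scheme \<Rightarrow> ('a, 'm, 's) module_scheme \<Rightarrow> ('a, 'l, 't) module_scheme
     \<Rightarrow> ('m \<Rightarrow> 'l) set" where
  "mod_hom R M N =
     {f \<in> carrier M \<rightarrow> carrier N.
        (\<forall>x\<in>carrier M. \<forall>y\<in>carrier M. f (x \<oplus>\<^bsub>M\<^esub> y) = f x \<oplus>\<^bsub>N\<^esub> f y) \<and>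
        (\<forall>a\<in>carrier R. \<forall>x\<in>carrier M. f (a \<odot>\<^bsub>M\<^esub> x) = a \<odot>\<^bsub>N\<^esub> f x)}"

text \<open>The quotient \<open>R/I\<close> as an \<open>R\<close>-module.\<close>

definition quotient_module :: "('a, 'r) ring_scheme \<Rightarrow> 'a set \<Rightarrow> ('a, 'a set) module" where
  "quotient_module R I =
     ring.extend (R Quot I)
       (module.fields (\<lambda>a Y. (I +>\<^bsub>R\<^esub> a) \<otimes>\<^bsub>R Quot I\<^esub> Y))"

text \<open>
  Projectivity is the lifting property along surjections \<open>g : N \<rightarrow> Q\<close>.  HOL cannot quantify over
  the carrier types of \<open>N\<close> and \<open>Q\<close> inside a definition; the types below lose nothing.  They
  contain the surjection onto \<open>P\<close> of the free module on the carrier of \<open>P\<close> (finitely supported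
  functions \<open>'p \<Rightarrow> 'a\<close>).  Lifting the identity of \<open>P\<close> along it makes \<open>P\<close> a direct summand of a
  free module, and this gives the lifting property for modules on arbitrary types.
\<close>

definition projective_module :: "('a, 'r) ring_scheme \<Rightarrow> ('a, 'p) module \<Rightarrow> bool" where
  "projective_module R P \<longleftrightarrow> module R P \<and>
     (\<forall>(N :: ('a, 'p \<Rightarrow> 'a) module) (Q :: ('a, 'p) module) g f.
        module R N \<longrightarrow> module R Q \<longrightarrow>
        g \<in> mod_hom R N Q \<longrightarrow> g ` carrier N = carrier Q \<longrightarrow> f \<in> mod_hom R P Q \<longrightarrow>
        (\<exists>h\<in>mod_hom R P N. \<forall>x\<in>carrier P. g (h x) = f x))"

text \<open>
  \<open>\<dots> \<rightarrow> P 2 \<rightarrow> P 1 \<rightarrow> P 0 \<rightarrow> N \<rightarrow> 0\<close> is exact, where \<open>d i : P (i + 1) \<rightarrow> P i\<close> and \<open>e : P 0 \<rightarrow> N\<close>.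
\<close>

definition projective_resolution ::
  "('a, 'r) ring_scheme \<Rightarrow> ('a, 'm, 's) module_scheme
     \<Rightarrow> (nat \<Rightarrow> ('a, 'p) module) \<Rightarrow> (nat \<Rightarrow> 'p \<Rightarrow> 'p) \<Rightarrow> ('p \<Rightarrow> 'm) \<Rightarrow> bool" where
  "projective_resolution R N P d e \<longleftrightarrow>
     (\<forall>i. projective_module R (P i)) \<and>
     e \<in> mod_hom R (P 0) N \<and>
     (\<forall>i. d i \<in> mod_hom R (P (Suc i)) (P i)) \<and>
     e ` carrier (P 0) = carrier N \<and>
     d 0 ` carrier (P 1) = a_kernel (P 0) N e \<and>
     (\<forall>i. d (Suc i) ` carrier (P (Suc (Suc i))) = a_kernel (P (Suc i)) (P i) (d i))"

text \<open>
  The least length of a projective resolution, \<open>\<infinity>\<close> if there is no finite one; the zero module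
  gets \<open>0\<close>.  The modules of the resolution live on the type \<open>nat + 'm \<Rightarrow> 'a\<close>, which is large
  enough for the result to be independent of this choice: if \<open>N\<close> has a projective resolution of
  length \<open>l\<close> on any types, then by Schanuel's lemma it has one consisting of \<open>l\<close> canonical free
  modules \<open>F 0\<close>, \<dots>, \<open>F (l - 1)\<close> (each on the carrier of the preceding kernel, starting from \<open>N\<close>)
  and a final kernel, all of cardinality at most the maximum of \<open>|R|\<close>, \<open>|N|\<close> and aleph-zero.
\<close>

definition projective_dimension ::
  "('a, 'r) ring_scheme \<Rightarrow> ('a, 'm, 's) module_scheme \<Rightarrow> enat" where
  "projective_dimension R N =
     Inf {enat l |l. \<exists>(P :: nat \<Rightarrow> ('a, nat + 'm \<Rightarrow> 'a) module) d e.
            projective_resolution R N P d e \<and> (\<forall>i>l. carrier (P i) = {\<zero>\<^bsub>P i\<^esub>})}"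

end

theory Submission
  imports Defs "HOL-Library.Function_Algebras"
begin

text \<open>
  Contrapositively, if a squarefree monomial ideal \<open>M\<close> is different from \<open>(x\<^sub>1, \<dots>, x\<^sub>n)\<close>, then \<open>S/M\<close>
  has a projective resolution of length at most \<open>n - 1\<close>.  If \<open>M = S\<close>, the zero complex will do.
  Otherwise it suffices to resolve \<open>M\<close> by \<open>n - 1\<close> finite free modules.

  Such a resolution is built one variable at a time, always over the same ring \<open>S\<close>.  Fix a variable
  \<open>x\<close> and write \<open>M = A + x B\<close>, where \<open>A\<close> is generated by the squarefree monomials of \<open>M\<close> without \<open>x\<close>
  and \<open>B\<close> is the colon ideal of \<open>M\<close> by \<open>x\<close> (\<open>support_ideal_decompose\<close>).  Because \<open>M\<close> is squarefree,
  neither \<open>A\<close> nor \<open>B\<close> involves \<open>x\<close>.  Moreover \<open>A \<subseteq> B\<close> and \<open>A \<inter> x B = x A\<close>, so there is an exact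
  sequence \<open>0 \<rightarrow> A \<rightarrow> A \<oplus> B \<rightarrow> M \<rightarrow> 0\<close>, and its mapping cone (\<open>mapping_cone\<close>) resolves \<open>M\<close> by \<open>l + 1\<close>
  modules if \<open>A\<close> has a resolution by \<open>l\<close> and \<open>B\<close> one by \<open>l + 1\<close> modules.  Induction then gives at most
  \<open>n\<close> modules for every proper \<open>M\<close>, and at most \<open>n - 1\<close> unless \<open>M\<close> is generated by all the variables:
  if \<open>A\<close> is generated by all variables except \<open>x\<close>, then either \<open>B = S\<close> and \<open>M = (x\<^sub>1, \<dots>, x\<^sub>n)\<close>, or
  \<open>B = A = M\<close> and \<open>M\<close> needs only as many modules as there are variables other than \<open>x\<close>
  (\<open>has_free_res_support_ideal\<close>).

  The homological algebra is done with explicit matrices.  A module is a submodule of the vectors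
  \<open>nat \<Rightarrow> S\<close>, a resolution is an iterated choice of finitely many generators and passage to their
  syzygies, and the mapping cone is reduced to the horseshoe lemma (\<open>horseshoe\<close>).  The resulting
  matrices define the projective resolution of \<open>S/M\<close> (\<open>projective_dimension_le\<close>).
\<close>

section \<open>Vectors, linear combinations and syzygies\<close>

definition vscale :: "'a::comm_ring_1 \<Rightarrow> ('j \<Rightarrow> 'a) \<Rightarrow> 'j \<Rightarrow> 'a" where
  "vscale a f = (\<lambda>j. a * f j)"

lemma vscale_apply: "vscale a f j = a * f j"
  by (simp add: vscale_def)

text \<open>
  Zero vectors are kept as constants: pointwise rewriting would turn hypotheses such as
  \<open>g x = 0\<close> into statements about abstractions that no longer match.
\<close>

declare zero_fun_apply [simp del]

global_interpretation vec: Modules.module vscale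
  by unfold_locales (auto simp: fun_eq_iff vscale_apply algebra_simps)

abbreviation linear_map :: "(('i \<Rightarrow> 'a::comm_ring_1) \<Rightarrow> ('j \<Rightarrow> 'a)) \<Rightarrow> bool" where
  "linear_map \<equiv> module_hom vscale vscale"

lemma linear_mapI:
  assumes "\<And>x y. g (x + y) = g x + g y" "\<And>a x. g (vscale a x) = vscale a (g x)"
  shows "linear_map g"
  using assms by unfold_locales auto

lemma subspace_kernel_on:
  assumes "linear_map g" "vec.subspace N"
  shows "vec.subspace {x \<in> N. g x = 0}"
proof -
  interpret module_hom vscale vscale g by fact
  show ?thesis using assms(2) by (auto simp: vec.subspace_def add scale zero)
qed

text \<open>
  All matrices are families \<open>v\<close> of which only the first \<open>r\<close> members count; \<open>lincomb r v\<close> is then the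
  linear map with columns \<open>v 0, \<dots>, v (r - 1)\<close>, defined on all vectors.  Its domain as a map of
  free modules is the space of vectors supported below \<open>r\<close>, so the support condition in \<open>syz\<close> makes
  that set the kernel of a map from \<open>R\<^sup>r\<close>; without it the kernel would contain an infinite
  product.
\<close>

definition lincomb :: "nat \<Rightarrow> (nat \<Rightarrow> 'j \<Rightarrow> 'a::comm_ring_1) \<Rightarrow> (nat \<Rightarrow> 'a) \<Rightarrow> 'j \<Rightarrow> 'a" where
  "lincomb r v c = (\<Sum>i<r. vscale (c i) (v i))"

definition syz :: "nat \<Rightarrow> (nat \<Rightarrow> 'j \<Rightarrow> 'a::comm_ring_1) \<Rightarrow> (nat \<Rightarrow> 'a) set" where
  "syz r v = {c. (\<forall>i\<ge>r. c i = 0) \<and> lincomb r v c = 0}"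

lemma linear_lincomb: "linear_map (lincomb r v)"
  by (rule linear_mapI)
    (simp_all add: lincomb_def vec.scale_left_distrib sum.distrib vec.scale_sum_right vscale_apply)

lemma lincomb_0 [simp]: "lincomb r v 0 = 0"
  by (simp add: lincomb_def zero_fun_apply)

lemma lincomb_rank_0 [simp]: "lincomb 0 v = (\<lambda>c. 0)"
  by (simp add: lincomb_def fun_eq_iff)

lemma linear_map_lincomb:
  assumes "linear_map g"
  shows "g (lincomb r v c) = lincomb r (\<lambda>i. g (v i)) c"
proof -
  interpret module_hom vscale vscale g by fact
  show ?thesis by (simp add: lincomb_def sum scale)
qed

lemma lincomb_cong:
  assumes "\<And>i. i < r \<Longrightarrow> v i = w i" "\<And>i. i < r \<Longrightarrow> c i = d i"
  shows "lincomb r v c = lincomb r w d"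
  unfolding lincomb_def using assms by (intro sum.cong) auto

lemma lincomb_in_subspace:
  assumes "vec.subspace N" "\<And>i. i < r \<Longrightarrow> v i \<in> N"
  shows "lincomb r v c \<in> N"
  unfolding lincomb_def using assms by (intro vec.subspace_sum vec.subspace_scale) auto

lemma lincomb_unit:
  assumes "i < r"
  shows "lincomb r v (\<lambda>j. if j = i then 1 else 0) = v i"
proof -
  have "lincomb r v (\<lambda>j. if j = i then 1 else 0) = (\<Sum>j<r. if j = i then v i else 0)"
    unfolding lincomb_def by (intro sum.cong) auto
  then show ?thesis using assms by simp
qed

lemma generator_in_range: "i < r \<Longrightarrow> v i \<in> range (lincomb r v)"
  by (metis lincomb_unit rangeI)

lemma subspace_range_lincomb: "vec.subspace (range (lincomb r v))"
  by (rule module_hom.subspace_image[OF linear_lincomb vec.subspace_UNIV])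

lemma subspace_syz: "vec.subspace (syz r v)"
proof -
  interpret module_hom vscale vscale "lincomb r v" by (rule linear_lincomb)
  show ?thesis by (auto simp: syz_def vec.subspace_def add scale vscale_apply zero_fun_apply)
qed

section \<open>Free resolutions of finite length and the horseshoe lemma\<close>

definition shift :: "nat \<Rightarrow> (nat \<Rightarrow> 'b) \<Rightarrow> nat \<Rightarrow> 'b" where
  "shift r c = (\<lambda>i. c (r + i))"

definition append_at :: "nat \<Rightarrow> (nat \<Rightarrow> 'b) \<Rightarrow> (nat \<Rightarrow> 'b) \<Rightarrow> nat \<Rightarrow> 'b" where
  "append_at r v w = (\<lambda>i. if i < r then v i else w (i - r))"

lemma shift_append_at [simp]: "shift r (append_at r v w) = w"
  by (simp add: shift_def append_at_def)

lemma linear_shift: "linear_map (shift r)"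
  by (rule linear_mapI) (auto simp: shift_def fun_eq_iff vscale_apply)

lemma lincomb_append:
  fixes v w :: "nat \<Rightarrow> 'j \<Rightarrow> 'a::comm_ring_1"
  shows
  "lincomb (r + s) (append_at r v w) c = lincomb r v c + lincomb s w (shift r c)"
proof (induction s)
  case 0
  show ?case by (auto intro: lincomb_cong simp: append_at_def)
next
  case (Suc s)
  have "lincomb (Suc n) u d = lincomb n u d + vscale (d n) (u n)"
    for n d and u :: "nat \<Rightarrow> 'j \<Rightarrow> 'a"
    by (simp add: lincomb_def)
  with Suc show ?case by (simp add: add.assoc) (simp add: append_at_def shift_def)
qed

lemma lincomb_append_append:
  "lincomb (r + s) (append_at r v w) (append_at r b c) = lincomb r v b + lincomb s w c"
  unfolding lincomb_append by (simp, rule lincomb_cong) (auto simp: append_at_def)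

text \<open>
  \<open>has_free_res l N\<close> says that there is an exact sequence
  \<open>0 \<rightarrow> F\<^sub>l \<rightarrow> \<dots> \<rightarrow> F\<^sub>1 \<rightarrow> N \<rightarrow> 0\<close> with finite free modules \<open>F\<^sub>i\<close>, so \<open>l\<close> counts the modules, and
  for \<open>l \<ge> 1\<close> the projective dimension of \<open>N\<close> is at most \<open>l - 1\<close>.  The definition peels off one presentation at a
  time.  Every syzygy module lies again in \<open>nat \<Rightarrow> 'a\<close>, so that modules, kernels and direct sums all
  live on one type and inductions on \<open>l\<close> can vary the module.
\<close>

primrec has_free_res :: "nat \<Rightarrow> (nat \<Rightarrow> 'a::comm_ring_1) set \<Rightarrow> bool" where
  "has_free_res 0 N \<longleftrightarrow> N = {0}"
| "has_free_res (Suc l) N \<longleftrightarrow> (\<exists>r v. N = range (lincomb r v) \<and> has_free_res l (syz r v))"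

lemma has_free_res_subspace: "has_free_res l N \<Longrightarrow> vec.subspace N"
  by (cases l) (auto simp: subspace_range_lincomb)

lemma syz_rank_0 [simp]: "syz 0 v = {0}"
  by (auto simp: syz_def fun_eq_iff zero_fun_apply)

lemma has_free_res_zero [simp]: "has_free_res l {0 :: nat \<Rightarrow> 'a::comm_ring_1}"
proof (induction l)
  case (Suc l)
  fix v :: "nat \<Rightarrow> nat \<Rightarrow> 'a"
  have "{0} = range (lincomb 0 v)" by (simp add: image_constant_conv)
  moreover have "has_free_res l (syz 0 v)" using Suc by (simp only: syz_rank_0)
  ultimately show ?case unfolding has_free_res.simps by blast
qed (rule has_free_res.simps(1)[THEN iffD2, OF refl])

lemma has_free_res_Suc: "has_free_res l N \<Longrightarrow> has_free_res (Suc l) N"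
proof (induction l arbitrary: N)
  case 0
  then show ?case using has_free_res_zero[of "Suc 0"] by simp
next
  case (Suc l)
  then show ?case by (metis has_free_res.simps(2))
qed

text \<open>
  The left exact half of the sequence of kernels in the horseshoe lemma: a relation between \<open>v\<close> and
  \<open>w\<close> that does not involve \<open>w\<close> is a relation between the \<open>v\<close>.  As vectors are functions on all
  of \<open>nat\<close>, the inclusion of coordinates is the identity and the two sets agree literally.
\<close>

lemma syz_append_kernel_shift: "{c \<in> syz (r + s) (append_at r v w). shift r c = 0} = syz r v"
proof (intro Set.set_eqI iffI)
  fix c assume c: "c \<in> {c \<in> syz (r + s) (append_at r v w). shift r c = 0}"
  then have "shift r c (i - r) = 0" for i by (simp add: zero_fun_apply)
  then have "c i = 0" if "i \<ge> r" for i using that by (simp add: shift_def) (metis le_add_diff_inverse)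
  with c show "c \<in> syz r v" by (auto simp: syz_def lincomb_append)
next
  fix c assume c: "c \<in> syz r v"
  then have "shift r c = 0" by (auto simp: shift_def fun_eq_iff syz_def zero_fun_apply)
  with c show "c \<in> {c \<in> syz (r + s) (append_at r v w). shift r c = 0}"
    by (auto simp: syz_def lincomb_append)
qed

lemma lincomb_truncated:
  obtains b where "\<forall>i\<ge>r. b i = 0" "lincomb r v b = lincomb r v c"
proof
  show "\<forall>i\<ge>r. (if i < r then c i else 0) = 0" by simp
  show "lincomb r v (\<lambda>i. if i < r then c i else 0) = lincomb r v c" by (rule lincomb_cong) auto
qed

text \<open>
  The horseshoe lemma for \<open>0 \<rightarrow> ker g \<rightarrow> N \<rightarrow> g N \<rightarrow> 0\<close>.  Generators of the kernel together with lifts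
  of generators of the image generate \<open>N\<close>, and dropping the coordinates of the former maps the
  syzygies of this combined system onto the syzygies of the image, with the syzygies of the kernel
  as kernel.  The induction continues with this sequence of syzygy modules.
\<close>

lemma horseshoe:
  assumes "linear_map g" "vec.subspace N"
    and "has_free_res l {x \<in> N. g x = 0}" "has_free_res l (g ` N)"
  shows "has_free_res l N"
  using assms
proof (induction l arbitrary: N g)
  case 0
  have "x = 0" if "x \<in> N" for x
  proof -
    have "g x = 0" using 0(4) that unfolding has_free_res.simps by blast
    with 0(3) that show "x = 0" unfolding has_free_res.simps by blast
  qed
  with vec.subspace_0[OF 0(2)] show ?case unfolding has_free_res.simps by blast
next
  case (Suc l)
  interpret module_hom vscale vscale g by fact
  obtain r v where v: "{x \<in> N. g x = 0} = range (lincomb r v)" "has_free_res l (syz r v)"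
    using Suc.prems(3) unfolding has_free_res.simps by blast
  obtain s w where w: "g ` N = range (lincomb s w)" "has_free_res l (syz s w)"
    using Suc.prems(4) unfolding has_free_res.simps by blast
  have "\<forall>i<s. w i \<in> g ` N" unfolding w(1) using generator_in_range by blast
  then obtain w' where w': "i < s \<Longrightarrow> w' i \<in> N \<and> g (w' i) = w i" for i
    by (simp add: image_iff) metis
  have v_in: "v i \<in> N \<and> g (v i) = 0" if "i < r" for i
    using generator_in_range[OF that, of v] unfolding v(1)[symmetric] by simp
  have g_w': "g (lincomb s w' c) = lincomb s w c" for c
    unfolding linear_map_lincomb[OF Suc.prems(1)] by (rule lincomb_cong) (auto simp: w')
  have w'_N: "lincomb s w' c \<in> N" for c
    using lincomb_in_subspace Suc.prems(2) w' by blast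
  define u where "u = append_at r v w'"
  have "N = range (lincomb (r + s) u)"
  proof (intro Set.set_eqI iffI)
    fix x assume x: "x \<in> N"
    then obtain c where c: "g x = lincomb s w c" using w(1) by blast
    have "x - lincomb s w' c \<in> {x \<in> N. g x = 0}"
      using x w'_N Suc.prems(2) c g_w' by (auto simp: diff vec.subspace_diff)
    then obtain b where "x - lincomb s w' c = lincomb r v b" using v(1) by blast
    then have "x = lincomb (r + s) u (append_at r b c)"
      unfolding u_def lincomb_append_append by (simp add: algebra_simps)
    then show "x \<in> range (lincomb (r + s) u)" by blast
  next
    fix x assume "x \<in> range (lincomb (r + s) u)"
    then show "x \<in> N"
      using lincomb_in_subspace[OF Suc.prems(2)] v_in w' by (auto simp: u_def append_at_def)
  qed
  moreover have "has_free_res l (syz (r + s) u)"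
  proof (rule Suc.IH[OF linear_shift subspace_syz])
    show "has_free_res l {c \<in> syz (r + s) u. shift r c = 0}"
      unfolding u_def syz_append_kernel_shift by (fact v(2))
    have "shift r ` syz (r + s) u = syz s w"
    proof (intro Set.set_eqI iffI)
      fix c assume "c \<in> shift r ` syz (r + s) u"
      then obtain b where b: "\<forall>i\<ge>r + s. b i = 0" "lincomb r v b + lincomb s w' c = 0" "c = shift r b"
        by (auto simp: syz_def u_def lincomb_append)
      have "g (lincomb r v b) = 0" using v(1) by blast
      then have "g (lincomb s w' c) = 0" using arg_cong[OF b(2), of g] by (simp add: add zero)
      then show "c \<in> syz s w" using b by (simp add: syz_def g_w' shift_def)
    next
      fix c assume c: "c \<in> syz s w"
      \<comment> \<open>A relation of the image lifts: its value in \<open>N\<close> lies in the kernel of \<open>g\<close> and can be cancelled.\<close>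
      have "lincomb s w' c \<in> {x \<in> N. g x = 0}" using c w'_N g_w' by (simp add: syz_def)
      then have "- lincomb s w' c \<in> {x \<in> N. g x = 0}"
        using Suc.prems(2) by (auto simp: neg vec.subspace_neg)
      then obtain b where b: "- lincomb s w' c = lincomb r v b" using v(1) by blast
      have "append_at r b c \<in> syz (r + s) u"
        using c by (auto simp: syz_def u_def lincomb_append_append simp flip: b) (auto simp: append_at_def)
      then show "c \<in> shift r ` syz (r + s) u" by (rule image_eqI[rotated]) (simp add: u_def)
    qed
    then show "has_free_res l (shift r ` syz (r + s) u)" using w(2) by simp
  qed
  ultimately show ?case by auto
qed

text \<open>
  The mapping cone of \<open>0 \<rightarrow> x A \<rightarrow> A \<oplus> x B \<rightarrow> A + x B \<rightarrow> 0\<close>, where \<open>A \<inter> x B = x A\<close> by the colon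
  condition and \<open>A \<subseteq> B\<close>.  A relation \<open>a + x b = 0\<close> between the generators of \<open>A\<close> and those of \<open>x B\<close> is
  recorded by the element \<open>b\<close>, which ranges over \<open>A\<close>; the relations with \<open>b = 0\<close> are the direct sum
  of the relations of \<open>A\<close> and of \<open>B\<close>.  Two applications of the horseshoe lemma bound the resolution
  of this syzygy module.
\<close>

lemma mapping_cone:
  assumes A: "has_free_res l A" and B: "has_free_res (Suc l) B" and "A \<subseteq> B"
    and colon: "\<And>b. b \<in> B \<Longrightarrow> vscale x b \<in> A \<Longrightarrow> b \<in> A"
  shows "has_free_res (Suc l) {a + vscale x b |a b. a \<in> A \<and> b \<in> B}"
proof -
  obtain r v where v: "A = range (lincomb r v)" "has_free_res l (syz r v)"
    using has_free_res_Suc[OF A] by auto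
  obtain s w where w: "B = range (lincomb s w)" "has_free_res l (syz s w)"
    using B by auto
  have subA: "vec.subspace A" using A by (rule has_free_res_subspace)
  define u where "u = append_at r v (\<lambda>i. vscale x (w i))"
  have lin_scale: "linear_map (vscale x)"
    by (rule linear_mapI) (auto simp: fun_eq_iff vscale_apply algebra_simps)
  have lincomb_u: "lincomb (r + s) u c = lincomb r v c + vscale x (lincomb s w (shift r c))" for c
    unfolding u_def lincomb_append linear_map_lincomb[OF lin_scale] ..
  have lincomb_u_append: "lincomb (r + s) u (append_at r b c) = lincomb r v b + vscale x (lincomb s w c)"
    for b c unfolding u_def lincomb_append_append linear_map_lincomb[OF lin_scale] ..
  have "{a + vscale x b |a b. a \<in> A \<and> b \<in> B} = range (lincomb (r + s) u)"
  proof (intro Set.set_eqI iffI)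
    fix y assume "y \<in> {a + vscale x b |a b. a \<in> A \<and> b \<in> B}"
    then obtain b c where "y = lincomb r v b + vscale x (lincomb s w c)" using v(1) w(1) by auto
    then show "y \<in> range (lincomb (r + s) u)" by (metis lincomb_u_append rangeI)
  next
    fix y assume "y \<in> range (lincomb (r + s) u)"
    then show "y \<in> {a + vscale x b |a b. a \<in> A \<and> b \<in> B}"
      unfolding v(1) w(1) using lincomb_u by blast
  qed
  moreover have "has_free_res l (syz (r + s) u)"
  proof (rule horseshoe)
    define g where "g c = lincomb s w (shift r c)" for c
    show "linear_map g" 
      unfolding g_def using module_hom_compose[OF linear_shift linear_lincomb] by (simp add: o_def)
    show "vec.subspace (syz (r + s) u)" by (rule subspace_syz)
    have "g ` syz (r + s) u = A"
    proof (intro Set.set_eqI iffI)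
      fix a assume "a \<in> g ` syz (r + s) u"
      then obtain c where c: "a = g c" "lincomb r v c + vscale x a = 0"
        by (auto simp: g_def syz_def lincomb_u)
      then have "vscale x a = - lincomb r v c" by (simp add: eq_neg_iff_add_eq_0 add.commute)
      then have "vscale x a \<in> A" using v(1) subA vec.subspace_neg by (metis rangeI)
      moreover have "a \<in> B" using c(1) w(1) by (simp add: g_def)
      ultimately show "a \<in> A" by (rule colon[rotated])
    next
      fix a assume a: "a \<in> A"
      then obtain c0 where "a = lincomb s w c0" using \<open>A \<subseteq> B\<close> w(1) by blast
      then obtain c where c: "\<forall>i\<ge>s. c i = 0" "a = lincomb s w c"
        by (metis lincomb_truncated)
      \<comment> \<open>The relation pairs \<open>a\<close>, written in the generators of \<open>B\<close>, with \<open>- x a\<close>, written in those of \<open>A\<close>.\<close>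
      have "- vscale x a \<in> A" using subA a by (simp add: vec.subspace_neg vec.subspace_scale)
      then obtain b where b: "- vscale x a = lincomb r v b" using v(1) by auto
      have "append_at r b c \<in> syz (r + s) u"
        using c(1) by (simp add: syz_def lincomb_u_append flip: b c(2)) (simp add: append_at_def)
      moreover have "g (append_at r b c) = a" by (simp add: g_def c)
      ultimately show "a \<in> g ` syz (r + s) u" by blast
    qed
    with A show "has_free_res l (g ` syz (r + s) u)" by simp
    show "has_free_res l {c \<in> syz (r + s) u. g c = 0}" (is "has_free_res l ?D")
    proof (rule horseshoe[OF linear_shift])
      show "vec.subspace ?D"
        by (rule subspace_kernel_on[OF \<open>linear_map g\<close> subspace_syz])
      have "{c \<in> ?D. shift r c = 0} = {c \<in> syz (r + s) u. shift r c = 0}" by (auto simp: g_def)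
      then show "has_free_res l {c \<in> ?D. shift r c = 0}"
        using v(2) by (simp add: u_def syz_append_kernel_shift)
      have "shift r ` ?D = syz s w"
      proof (intro Set.set_eqI iffI)
        fix c assume "c \<in> shift r ` ?D"
        then show "c \<in> syz s w" by (auto simp: syz_def g_def shift_def)
      next
        fix c assume c: "c \<in> syz s w"
        then have "append_at r 0 c \<in> ?D"
          by (auto simp: syz_def g_def lincomb_u_append) (auto simp: append_at_def zero_fun_apply)
        then show "c \<in> shift r ` ?D" by (rule image_eqI[rotated]) simp
      qed
      then show "has_free_res l (shift r ` ?D)" using w(2) by simp
    qed
  qed
  ultimately show ?thesis by auto
qed

text \<open>
  Unrolling the recursion yields the ranks and matrices of the whole resolution, in the form in
  which \<open>projective_dimension_le\<close> turns them into a complex.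
\<close>

lemma has_free_res_sequence:
  assumes "has_free_res l N"
  obtains r v where "N = range (lincomb (r 0) (v 0))"
    "\<And>i. syz (r i) (v i) = range (lincomb (r (Suc i)) (v (Suc i)))" "\<And>i. i \<ge> l \<Longrightarrow> r i = 0"
  using assms
proof (induction l arbitrary: N thesis)
  case 0
  show ?case
    by (rule "0.prems"(1)[of "\<lambda>_. 0" "\<lambda>_ _. 0"]) (use "0.prems"(2) in auto)
next
  case (Suc l)
  then obtain r0 v0 where 1: "N = range (lincomb r0 v0)" "has_free_res l (syz r0 v0)" by auto
  obtain r v where 2: "syz r0 v0 = range (lincomb (r 0) (v 0))"
    "\<And>i. syz (r i) (v i) = range (lincomb (r (Suc i)) (v (Suc i)))" "\<And>i. i \<ge> l \<Longrightarrow> r i = 0"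
    using Suc.IH[OF _ 1(2)] by blast
  show ?case
    by (rule Suc.prems(1)[of "case_nat r0 r" "case_nat v0 v"])
       (use 1 2 in \<open>auto split: nat.split\<close>)
qed

section \<open>Squarefree monomial ideals as families of supports\<close>

text \<open>
  The polynomials in which the set of variables of every term belongs to \<open>\<Gamma>\<close>.  For up-closed \<open>\<Gamma>\<close>
  these are exactly the squarefree monomial ideals; \<open>\<Gamma>\<close> is then the family of non-faces of the
  Stanley--Reisner complex.  In this form there are no generators to keep track of, and deletion and
  link of a variable are plain operations on families of sets.
\<close>

definition support_ideal :: "'n set set \<Rightarrow> ('n::finite, 'k::field) mpoly set" where
  "support_ideal \<Gamma> = {p. \<forall>m\<in>Poly_Mapping.keys p. Poly_Mapping.keys m \<in> \<Gamma>}"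

abbreviation up_closed :: "'n set set \<Rightarrow> bool" where
  "up_closed \<Gamma> \<equiv> \<forall>T\<in>\<Gamma>. \<forall>U. T \<subseteq> U \<longrightarrow> U \<in> \<Gamma>"

lemma keys_exponent_add:
  fixes a b :: "'n \<Rightarrow>\<^sub>0 nat"
  shows "Poly_Mapping.keys (a + b) = Poly_Mapping.keys a \<union> Poly_Mapping.keys b"
  by (auto simp: in_keys_iff lookup_add)

lemma sum_terms:
  "(\<Sum>m\<in>Poly_Mapping.keys p. Poly_Mapping.single m (Poly_Mapping.lookup p m)) = p"
  by (rule poly_mapping_eqI)
     (simp add: lookup_sum lookup_single when_def in_keys_iff)

lemma support_ideal_zero: "0 \<in> support_ideal \<Gamma>"
  by (simp add: support_ideal_def)

lemma support_ideal_add: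
  "p \<in> support_ideal \<Gamma> \<Longrightarrow> q \<in> support_ideal \<Gamma> \<Longrightarrow> p + q \<in> support_ideal \<Gamma>"
  unfolding support_ideal_def using keys_add[of p q] by auto

lemma support_ideal_mult:
  assumes "up_closed \<Gamma>" "p \<in> support_ideal \<Gamma>"
  shows "q * p \<in> support_ideal \<Gamma>"
  unfolding support_ideal_def
proof (intro CollectI ballI)
  fix m assume "m \<in> Poly_Mapping.keys (q * p)"
  then obtain a b where "m = a + b" "b \<in> Poly_Mapping.keys p"
    using keys_mult[of q p] by blast
  with assms show "Poly_Mapping.keys m \<in> \<Gamma>"
    by (auto simp: support_ideal_def keys_exponent_add)
qed

lemma support_ideal_mono: "\<Gamma> \<subseteq> \<Delta> \<Longrightarrow> support_ideal \<Gamma> \<subseteq> support_ideal \<Delta>"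
  by (auto simp: support_ideal_def)

lemma support_ideal_single:
  "Poly_Mapping.keys m \<in> \<Gamma> \<Longrightarrow> Poly_Mapping.single m c \<in> support_ideal \<Gamma>"
  by (simp add: support_ideal_def)

lemma support_ideal_induct [consumes 1, case_names zero add single]:
  assumes "p \<in> support_ideal \<Gamma>" and "P 0"
    and add: "\<And>p q. P p \<Longrightarrow> P q \<Longrightarrow> P (p + q)"
    and single: "\<And>m c. Poly_Mapping.keys m \<in> \<Gamma> \<Longrightarrow> P (Poly_Mapping.single m c)"
  shows "P p"
proof -
  have "P (\<Sum>m\<in>Q. Poly_Mapping.single m (Poly_Mapping.lookup p m))"
    if "finite Q" "Q \<subseteq> Poly_Mapping.keys p" for Q
    using that
  proof induction
    case (insert m Q)
    then show ?case using assms(1) by (simp add: support_ideal_def add single)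
  qed (simp add: \<open>P 0\<close>)
  then show ?thesis using sum_terms[of p] by (metis finite_keys order_refl)
qed

lemma lookup_single_mult:
  fixes p :: "('n::finite, 'k::field) mpoly"
  shows "Poly_Mapping.lookup (Poly_Mapping.single a 1 * p) (a + m) = Poly_Mapping.lookup p m"
proof -
  have "Poly_Mapping.single a 1 * p =
      (\<Sum>m\<in>Poly_Mapping.keys p. Poly_Mapping.single (a + m) (Poly_Mapping.lookup p m))"
    by (subst (1) sum_terms[of p, symmetric]) (simp add: sum_distrib_left mult_single)
  then show ?thesis
    by (simp add: lookup_sum lookup_single when_def in_keys_iff)
qed

lemma split_off_exponent:
  fixes m g :: "'n \<Rightarrow>\<^sub>0 nat"
  assumes "\<And>i. Poly_Mapping.lookup g i \<le> Poly_Mapping.lookup m i"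
  shows "g + (m - g) = m"
  using assms by (intro poly_mapping_eqI) (simp add: lookup_add lookup_minus)

text \<open>
  Terms free of \<open>x\<close> already lie in the first summand, and from every other term one factor \<open>x\<close> can
  be split off.  The first family belongs to the ideal generated by the monomials without \<open>x\<close>, the
  second to the colon ideal by \<open>x\<close>; neither depends on \<open>x\<close> any more, which drives the induction
  on the number of variables.
\<close>

lemma support_ideal_decompose:
  fixes x :: "'n::finite" and \<Gamma> :: "'n set set"
  assumes up: "up_closed \<Gamma>"
  shows "(support_ideal \<Gamma> :: ('n, 'k::field) mpoly set) =
    {a + variable x * b |a b. a \<in> support_ideal {T. T - {x} \<in> \<Gamma>}
                             \<and> b \<in> support_ideal {T. insert x T \<in> \<Gamma>}}"
    (is "_ = ?R")
proof (intro Set.set_eqI iffI)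
  fix p :: "('n, 'k) mpoly" assume "p \<in> support_ideal \<Gamma>"
  then show "p \<in> ?R"
  proof (induction rule: support_ideal_induct)
    case zero
    have "0 = 0 + variable x * (0 :: ('n, 'k) mpoly)" by simp
    then show ?case using support_ideal_zero by blast
  next
    case (add p q)
    then obtain a b a' b' where
      *: "a \<in> support_ideal {T. T - {x} \<in> \<Gamma>}" "b \<in> support_ideal {T. insert x T \<in> \<Gamma>}"
        "a' \<in> support_ideal {T. T - {x} \<in> \<Gamma>}" "b' \<in> support_ideal {T. insert x T \<in> \<Gamma>}"
        "p = a + variable x * b" "q = a' + variable x * b'" by blast
    then have "p + q = (a + a') + variable x * (b + b')" by (simp add: algebra_simps)
    then show ?case using * support_ideal_add by blast
  next
    case (single m c)
    show ?case
    proof (cases "x \<in> Poly_Mapping.keys m")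
      case True
      let ?e = "Poly_Mapping.single x (1::nat)"
      have m: "?e + (m - ?e) = m"
        using True by (intro split_off_exponent) (auto simp: lookup_single when_def in_keys_iff)
      have "insert x (Poly_Mapping.keys (m - ?e)) = Poly_Mapping.keys m"
        using keys_exponent_add[of ?e "m - ?e"] unfolding m by simp
      then have "Poly_Mapping.single (m - ?e) c \<in> support_ideal {T. insert x T \<in> \<Gamma>}"
        using single by (intro support_ideal_single) simp
      moreover have "Poly_Mapping.single m c = 0 + variable x * Poly_Mapping.single (m - ?e) c"
        unfolding variable_def monomial_def mult_single m by simp
      ultimately show ?thesis using support_ideal_zero by blast
    next
      case False
      then have "Poly_Mapping.single m c \<in> support_ideal {T. T - {x} \<in> \<Gamma>}"
        using single by (intro support_ideal_single) simp
      moreover have "Poly_Mapping.single m c = Poly_Mapping.single m c + variable x * 0" by simp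
      ultimately show ?thesis using support_ideal_zero by blast
    qed
  qed
next
  fix p :: "('n, 'k) mpoly" assume "p \<in> ?R"
  then obtain a b where p: "p = a + variable x * b"
    and a: "a \<in> support_ideal {T. T - {x} \<in> \<Gamma>}"
    and b: "b \<in> support_ideal {T. insert x T \<in> \<Gamma>}" by blast
  have "{T. T - {x} \<in> \<Gamma>} \<subseteq> \<Gamma>" using up by blast
  with a have "a \<in> support_ideal \<Gamma>" using support_ideal_mono by blast
  moreover have "variable x * b \<in> support_ideal \<Gamma>"
    unfolding support_ideal_def
  proof (intro CollectI ballI)
    fix m assume "m \<in> Poly_Mapping.keys (variable x * b)"
    then obtain m' where "m = Poly_Mapping.single x 1 + m'" "m' \<in> Poly_Mapping.keys b"
      using keys_mult[of "variable x" b] by (auto simp: variable_def monomial_def)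
    with b show "Poly_Mapping.keys m \<in> \<Gamma>" by (auto simp: keys_exponent_add support_ideal_def)
  qed
  ultimately show "p \<in> support_ideal \<Gamma>" unfolding p by (rule support_ideal_add)
qed

lemma support_ideal_colon:
  fixes b :: "('n::finite, 'k::field) mpoly"
  assumes "variable x * b \<in> support_ideal {T. T - {x} \<in> \<Gamma>}"
  shows "b \<in> support_ideal {T. T - {x} \<in> \<Gamma>}"
  unfolding support_ideal_def
proof (intro CollectI ballI)
  fix m assume m: "m \<in> Poly_Mapping.keys b"
  let ?m = "Poly_Mapping.single x (1::nat) + m"
  have "?m \<in> Poly_Mapping.keys (variable x * b)"
    using m by (simp add: in_keys_iff variable_def monomial_def lookup_single_mult)
  then have "Poly_Mapping.keys ?m - {x} \<in> \<Gamma>" using assms by (auto simp: support_ideal_def)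
  then show "Poly_Mapping.keys m - {x} \<in> \<Gamma>" by (simp add: keys_exponent_add)
qed

section \<open>Free resolutions of squarefree monomial ideals\<close>

text \<open>
  Ideals are placed in coordinate \<open>0\<close> in order to count as submodules of the type on which syzygies
  live.
\<close>

definition embed_ideal :: "'a::comm_ring_1 set \<Rightarrow> (nat \<Rightarrow> 'a) set" where
  "embed_ideal I = {f. f 0 \<in> I \<and> (\<forall>i>0. f i = 0)}"

lemma embed_zero: "embed_ideal {0} = {0 :: nat \<Rightarrow> 'a::comm_ring_1}"
  by (auto simp: embed_ideal_def fun_eq_iff zero_fun_apply) (metis gr0I)

lemma has_free_res_unit: "has_free_res (Suc l) (embed_ideal (UNIV :: 'a::comm_ring_1 set))"
proof -
  define v :: "nat \<Rightarrow> nat \<Rightarrow> 'a" where "v = (\<lambda>_ i. if i = 0 then 1 else 0)"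
  have v: "lincomb (Suc 0) v c = (\<lambda>i. if i = 0 then c 0 else 0)" for c
    by (simp add: lincomb_def v_def vscale_def fun_eq_iff)
  have "embed_ideal (UNIV :: 'a set) = range (lincomb (Suc 0) v)"
  proof (intro Set.set_eqI iffI)
    fix f :: "nat \<Rightarrow> 'a" assume "f \<in> embed_ideal UNIV"
    then have "f = lincomb (Suc 0) v f" by (auto simp: v embed_ideal_def)
    then show "f \<in> range (lincomb (Suc 0) v)" by blast
  qed (auto simp: v embed_ideal_def)
  moreover have "syz (Suc 0) v = {0}"
  proof -
    have "c = 0" if "c \<in> syz (Suc 0) v" for c
    proof
      fix i
      have "lincomb (Suc 0) v c 0 = 0" using that by (simp add: syz_def zero_fun_apply)
      then have "c 0 = 0" by (simp add: v)
      with that show "c i = 0 i" by (cases i) (auto simp: syz_def zero_fun_apply)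
    qed
    with vec.subspace_0[OF subspace_syz] show ?thesis by blast
  qed
  ultimately show ?thesis by (metis has_free_res.simps(2) has_free_res_zero)
qed

lemma embed_mapping_cone:
  fixes A B :: "'a::comm_ring_1 set"
  assumes "has_free_res l (embed_ideal A)" "has_free_res (Suc l) (embed_ideal B)" "A \<subseteq> B"
    and colon: "\<And>b. b \<in> B \<Longrightarrow> x * b \<in> A \<Longrightarrow> b \<in> A"
  shows "has_free_res (Suc l) (embed_ideal {a + x * b |a b. a \<in> A \<and> b \<in> B})"
proof -
  have "embed_ideal {a + x * b |a b. a \<in> A \<and> b \<in> B} =
      {a + vscale x b |a b. a \<in> embed_ideal A \<and> b \<in> embed_ideal B}"
  proof (intro Set.set_eqI iffI)
    fix f assume f: "f \<in> embed_ideal {a + x * b |a b. a \<in> A \<and> b \<in> B}"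
    then obtain a b where ab: "f 0 = a + x * b" "a \<in> A" "b \<in> B" by (auto simp: embed_ideal_def)
    let ?c = "\<lambda>p i. if i = 0 then p else 0 :: 'a"
    have "f = ?c a + vscale x (?c b)"
      using f ab by (auto simp: embed_ideal_def fun_eq_iff vscale_apply)
    moreover have "?c a \<in> embed_ideal A" "?c b \<in> embed_ideal B" using ab by (auto simp: embed_ideal_def)
    ultimately show "f \<in> {a + vscale x b |a b. a \<in> embed_ideal A \<and> b \<in> embed_ideal B}" by blast
  qed (auto simp: embed_ideal_def vscale_apply, blast)
  moreover have "has_free_res (Suc l) {a + vscale x b |a b. a \<in> embed_ideal A \<and> b \<in> embed_ideal B}"
  proof (rule mapping_cone)
    show "b \<in> embed_ideal A" if "b \<in> embed_ideal B" "vscale x b \<in> embed_ideal A" for b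
      using that colon by (auto simp: embed_ideal_def vscale_apply)
  qed (use assms in \<open>auto simp: embed_ideal_def\<close>)
  ultimately show ?thesis by simp
qed

text \<open>
  The heart of the proof, an induction on the set \<open>V\<close> of variables that may occur in the generators;
  the second conjunct saves one step of the resolution when the ideal is not \<open>(V)\<close>.  The first
  conjunct is needed along with it, both for the colon ideal \<open>B\<close> and for the case where the ideal
  does not involve the new variable.

  In the step from \<open>V\<close> to \<open>V \<union> {x}\<close>, with \<open>I = A + x B\<close>, the ideal \<open>A\<close> of generators without \<open>x\<close>
  enters the mapping cone one step later than \<open>B\<close>.  Hence the saved step is inherited from \<open>A\<close> unless \<open>A = (V)\<close>.  In that case \<open>B \<supseteq> (V)\<close>, so
  either \<open>B\<close> is the unit ideal and \<open>I = (V) + (x)\<close> is the excluded ideal, or \<open>B = (V)\<close> and \<open>I = (V)\<close>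
  has a resolution whose length is governed by the smaller set of variables.  A unit ideal \<open>B\<close> is
  free of rank one and never makes the cone longer.
\<close>

lemma has_free_res_support_ideal:
  fixes \<Gamma> :: "'n::finite set set"
  assumes "finite V" "up_closed \<Gamma>" "\<And>T. T \<in> \<Gamma> \<longleftrightarrow> T \<inter> V \<in> \<Gamma>" "{} \<notin> \<Gamma>"
  shows "has_free_res (card V) (embed_ideal (support_ideal \<Gamma> :: ('n, 'k::field) mpoly set)) \<and>
    (\<Gamma> \<noteq> {T. T \<inter> V \<noteq> {}} \<longrightarrow>
       has_free_res (card V - 1) (embed_ideal (support_ideal \<Gamma> :: ('n, 'k::field) mpoly set)))"
  using assms
proof (induction V arbitrary: \<Gamma> rule: finite_induct)
  case empty
  then have "\<Gamma> = {}" by auto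
  then have "support_ideal \<Gamma> = {0 :: ('n, 'k) mpoly}" by (auto simp: support_ideal_def)
  then show ?case using \<open>\<Gamma> = {}\<close> by (simp add: embed_zero)
next
  case (insert x V)
  note up = insert.prems(1) and dep = insert.prems(2) and proper = insert.prems(3)
  let ?I = "\<lambda>\<Gamma>. embed_ideal (support_ideal \<Gamma> :: ('n, 'k) mpoly set)"
  define \<Gamma>A where "\<Gamma>A = {T. T - {x} \<in> \<Gamma>}"
  define \<Gamma>B where "\<Gamma>B = {T. insert x T \<in> \<Gamma>}"
  have A: "up_closed \<Gamma>A" "T \<in> \<Gamma>A \<longleftrightarrow> T \<inter> V \<in> \<Gamma>A" "{} \<notin> \<Gamma>A" for T
  proof -
    show "up_closed \<Gamma>A"
    proof (intro ballI allI impI)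
      fix T U assume "T \<in> \<Gamma>A" "T \<subseteq> U"
      then have "T - {x} \<in> \<Gamma>" "T - {x} \<subseteq> U - {x}" by (auto simp: \<Gamma>A_def)
      with up have "U - {x} \<in> \<Gamma>" by blast
      then show "U \<in> \<Gamma>A" by (simp add: \<Gamma>A_def)
    qed
    have "T - {x} \<in> \<Gamma> \<longleftrightarrow> (T - {x}) \<inter> insert x V \<in> \<Gamma>" by (rule dep)
    also have "(T - {x}) \<inter> insert x V = (T \<inter> V - {x}) \<inter> insert x V" by blast
    also have "\<dots> \<in> \<Gamma> \<longleftrightarrow> T \<inter> V - {x} \<in> \<Gamma>" by (rule dep[symmetric])
    finally show "T \<in> \<Gamma>A \<longleftrightarrow> T \<inter> V \<in> \<Gamma>A" unfolding \<Gamma>A_def by blast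
    show "{} \<notin> \<Gamma>A" using proper by (simp add: \<Gamma>A_def)
  qed
  have B: "up_closed \<Gamma>B" "T \<in> \<Gamma>B \<longleftrightarrow> T \<inter> V \<in> \<Gamma>B" for T
  proof -
    show "up_closed \<Gamma>B"
    proof (intro ballI allI impI)
      fix T U assume "T \<in> \<Gamma>B" "T \<subseteq> U"
      then have "insert x T \<in> \<Gamma>" "insert x T \<subseteq> insert x U" by (auto simp: \<Gamma>B_def)
      with up have "insert x U \<in> \<Gamma>" by blast
      then show "U \<in> \<Gamma>B" by (simp add: \<Gamma>B_def)
    qed
    have "insert x T \<in> \<Gamma> \<longleftrightarrow> (insert x T) \<inter> insert x V \<in> \<Gamma>" by (rule dep)
    also have "(insert x T) \<inter> insert x V = (insert x (T \<inter> V)) \<inter> insert x V" by blast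
    also have "\<dots> \<in> \<Gamma> \<longleftrightarrow> insert x (T \<inter> V) \<in> \<Gamma>" by (rule dep[symmetric])
    finally show "T \<in> \<Gamma>B \<longleftrightarrow> T \<inter> V \<in> \<Gamma>B" unfolding \<Gamma>B_def by blast
  qed
  have AB: "\<Gamma>A \<subseteq> \<Gamma>B"
  proof
    fix T assume "T \<in> \<Gamma>A"
    moreover have "T - {x} \<subseteq> insert x T" by blast
    ultimately show "T \<in> \<Gamma>B" using up by (simp add: \<Gamma>A_def \<Gamma>B_def)
  qed
  have resB: "has_free_res (card V) (?I \<Gamma>B) \<or> \<Gamma>B = UNIV"
  proof (cases "{} \<in> \<Gamma>B")
    case True
    then have "\<Gamma>B = UNIV" using B(1) by (metis UNIV_eq_I empty_subsetI)
    then show ?thesis ..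
  qed (simp add: insert.IH[OF B])
  have unit: "has_free_res (Suc l) (?I UNIV)" for l
    using has_free_res_unit by (simp add: support_ideal_def)
  have cone: "has_free_res (Suc l) (?I \<Gamma>)"
    if "has_free_res l (?I \<Gamma>A)" "has_free_res (Suc l) (?I \<Gamma>B)" for l
  proof -
    have "has_free_res (Suc l) (embed_ideal {a + variable x * b |a b.
        a \<in> support_ideal \<Gamma>A \<and> b \<in> (support_ideal \<Gamma>B :: ('n, 'k) mpoly set)})"
      using that support_ideal_mono[OF AB] support_ideal_colon
      by (intro embed_mapping_cone) (auto simp: \<Gamma>A_def)
    then show ?thesis
      unfolding \<Gamma>A_def \<Gamma>B_def support_ideal_decompose[OF up, of x, symmetric] .
  qed
  have IHA: "has_free_res (card V) (?I \<Gamma>A)"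
    "\<Gamma>A \<noteq> {T. T \<inter> V \<noteq> {}} \<Longrightarrow> has_free_res (card V - 1) (?I \<Gamma>A)"
    using insert.IH[OF A] by blast+
  have card: "card (insert x V) = Suc (card V)" using insert.hyps by simp
  have "has_free_res (Suc (card V)) (?I \<Gamma>)"
    using cone[OF IHA(1)] resB unit has_free_res_Suc by blast
  moreover have "has_free_res (card V) (?I \<Gamma>)" if ne: "\<Gamma> \<noteq> {T. T \<inter> insert x V \<noteq> {}}"
  proof (cases "\<Gamma>A = {T. T \<inter> V \<noteq> {}}")
    case False
    show ?thesis
    proof (cases "card V")
      case 0
      \<comment> \<open>With \<open>V\<close> empty, the proper ideal \<open>A\<close> must be \<open>0 = (V)\<close>, which has just been excluded.\<close>
      then have "V = {}" using insert.hyps by simp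
      then have "\<Gamma>A = {}" using A(2,3) by auto
      with \<open>V = {}\<close> False show ?thesis by simp
    next
      case (Suc l)
      then show ?thesis using cone[of l] IHA(2)[OF False] resB unit by auto
    qed
  next
    case True
    have in_\<Gamma>A: "T \<in> \<Gamma>A \<longleftrightarrow> T \<in> \<Gamma>" if "x \<notin> T" for T using that by (simp add: \<Gamma>A_def)
    have "{} \<notin> \<Gamma>B"
    proof
      assume "{} \<in> \<Gamma>B"
      then have "{x} \<in> \<Gamma>" by (simp add: \<Gamma>B_def)
      then have "T \<in> \<Gamma>" if "x \<in> T" for T using up that by blast
      moreover have "T \<in> \<Gamma> \<longleftrightarrow> T \<inter> V \<noteq> {}" if "x \<notin> T" for T
        using in_\<Gamma>A[OF that] True by blast
      ultimately have "T \<in> \<Gamma> \<longleftrightarrow> T \<inter> insert x V \<noteq> {}" for T by (cases "x \<in> T") auto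
      with ne show False by blast
    qed
    have "\<Gamma>B \<subseteq> \<Gamma>A"
    proof
      fix T assume "T \<in> \<Gamma>B"
      then have "T \<inter> V \<in> \<Gamma>B" using B(2)[of T] by simp
      with \<open>{} \<notin> \<Gamma>B\<close> have "T \<inter> V \<noteq> {}" by metis
      then show "T \<in> \<Gamma>A" unfolding True by simp
    qed
    have "T \<in> \<Gamma> \<longleftrightarrow> T \<in> \<Gamma>A" for T
    proof (cases "x \<in> T")
      case True
      then have "T \<in> \<Gamma> \<longleftrightarrow> T \<in> \<Gamma>B" by (simp add: \<Gamma>B_def insert_absorb)
      with AB \<open>\<Gamma>B \<subseteq> \<Gamma>A\<close> show ?thesis by auto
    qed (simp add: in_\<Gamma>A)
    then have "\<Gamma> = \<Gamma>A" by blast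
    with IHA(1) show ?thesis by simp
  qed
  ultimately show ?case by (simp add: card)
qed

section \<open>Ideals generated by squarefree monomials\<close>

lemma mpoly_ring_simps [simp]:
  "carrier ring_of_type_algebra = UNIV" "\<zero>\<^bsub>ring_of_type_algebra\<^esub> = 0"
  "\<one>\<^bsub>ring_of_type_algebra\<^esub> = 1"
  "a \<oplus>\<^bsub>ring_of_type_algebra\<^esub> b = a + b" "a \<otimes>\<^bsub>ring_of_type_algebra\<^esub> b = a * b"
  by (simp_all add: ring_of_type_algebra_def)

lemma ideal_ring_of_type_algebraI:
  fixes I :: "'a::comm_ring_1 set"
  assumes "0 \<in> I" "\<And>p q. p \<in> I \<Longrightarrow> q \<in> I \<Longrightarrow> p + q \<in> I" "\<And>a p. p \<in> I \<Longrightarrow> a * p \<in> I"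
  shows "ideal I ring_of_type_algebra"
proof -
  interpret R: cring "ring_of_type_algebra :: 'a ring" by (rule cring_from_type_algebra)
  have minus: "\<ominus>\<^bsub>ring_of_type_algebra\<^esub> p = - p" for p :: 'a
    by (rule R.minus_equality) auto
  have "- p \<in> I" if "p \<in> I" for p using assms(3)[OF that, of "- 1"] by simp
  then have "subgroup I (add_monoid ring_of_type_algebra)"
    using assms by (intro R.add.subgroupI) (auto simp: minus)
  then show ?thesis
    using assms by (intro idealI R.ring_axioms) (auto simp: mult.commute)
qed

lemma monomial_inject [simp]: "(monomial m :: ('n::finite, 'k::field) mpoly) = monomial m' \<longleftrightarrow> m = m'"
  unfolding monomial_def by (metis keys_single singleton_inject zero_neq_one)

text \<open>
  A squarefree monomial divides a monomial as soon as its variables occur there, because all its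
  exponents are at most one.
\<close>

lemma Idl_squarefree:
  fixes G :: "('n::finite, 'k::field) mpoly set"
  assumes G: "G \<subseteq> squarefree_monomials"
  shows "Idl\<^bsub>mpoly_ring\<^esub> G = support_ideal {T. \<exists>m. monomial m \<in> G \<and> Poly_Mapping.keys m \<subseteq> T}"
    (is "_ = support_ideal ?\<Gamma>")
proof
  interpret R: cring "mpoly_ring :: ('n, 'k) mpoly ring" by (rule cring_from_type_algebra)
  have up: "up_closed ?\<Gamma>" by blast
  have "G \<subseteq> support_ideal ?\<Gamma>"
  proof
    fix g assume "g \<in> G"
    then obtain m where "g = monomial m" "monomial m \<in> G"
      using G by (auto simp: squarefree_monomials_def)
    then show "g \<in> support_ideal ?\<Gamma>" unfolding monomial_def
      by (auto simp: monomial_def intro!: support_ideal_single)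
  qed
  moreover have "ideal (support_ideal ?\<Gamma>) mpoly_ring"
    by (intro ideal_ring_of_type_algebraI support_ideal_zero support_ideal_add
        support_ideal_mult[OF up])
  ultimately show "Idl\<^bsub>mpoly_ring\<^esub> G \<subseteq> support_ideal ?\<Gamma>" by (rule R.genideal_minimal[rotated])
  interpret I: ideal "Idl\<^bsub>mpoly_ring\<^esub> G" "mpoly_ring :: ('n, 'k) mpoly ring"
    by (rule R.genideal_ideal) simp
  show "support_ideal ?\<Gamma> \<subseteq> Idl\<^bsub>mpoly_ring\<^esub> G"
  proof
    fix p :: "('n, 'k) mpoly" assume "p \<in> support_ideal ?\<Gamma>"
    then show "p \<in> Idl\<^bsub>mpoly_ring\<^esub> G"
    proof (induction rule: support_ideal_induct)
      case zero
      then show ?case using I.zero_closed by simp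
    next
      case (add p q)
      then show ?case using I.a_closed by fastforce
    next
      case (single m c)
      then obtain g where g: "monomial g \<in> G" "Poly_Mapping.keys g \<subseteq> Poly_Mapping.keys m" by blast
      then obtain g' where "(monomial g :: ('n, 'k) mpoly) = monomial g'"
        "\<forall>i. Poly_Mapping.lookup g' i \<le> 1"
        using G unfolding squarefree_monomials_def by blast
      then have sqfree: "Poly_Mapping.lookup g i \<le> 1" for i by simp
      have "Poly_Mapping.lookup g i \<le> Poly_Mapping.lookup m i" for i
      proof (cases "i \<in> Poly_Mapping.keys g")
        case True
        with g(2) have "Poly_Mapping.lookup m i \<noteq> 0" by (metis in_keys_iff subsetD)
        with sqfree[of i] show ?thesis by linarith
      qed (simp add: in_keys_iff)
      then have m: "g + (m - g) = m" by (rule split_off_exponent)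
      have "monomial g \<in> Idl\<^bsub>mpoly_ring\<^esub> G" using R.genideal_self[of G] g(1) by auto
      then have "monomial g * Poly_Mapping.single (m - g) c \<in> Idl\<^bsub>mpoly_ring\<^esub> G"
        using I.I_r_closed by fastforce
      then show ?case by (simp add: monomial_def mult_single m)
    qed
  qed
qed

lemma Idl_variables:
  "Idl\<^bsub>mpoly_ring\<^esub> (range variable) =
     (support_ideal {T. T \<noteq> {}} :: ('n::finite, 'k::field) mpoly set)"
proof -
  have "range variable \<subseteq> (squarefree_monomials :: ('n, 'k) mpoly set)"
    by (auto simp: squarefree_monomials_def variable_def lookup_single when_def)
  moreover have "(\<exists>m. monomial m \<in> range (variable :: 'n \<Rightarrow> ('n, 'k) mpoly) \<and>
      Poly_Mapping.keys m \<subseteq> T) \<longleftrightarrow> T \<noteq> {}" for T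
  proof
    assume "T \<noteq> {}"
    then obtain x where "x \<in> T" by blast
    then have "Poly_Mapping.keys (Poly_Mapping.single x (1::nat)) \<subseteq> T" by simp
    then show "\<exists>m. monomial m \<in> range (variable :: 'n \<Rightarrow> ('n, 'k) mpoly) \<and> Poly_Mapping.keys m \<subseteq> T"
      unfolding variable_def by blast
  qed (auto simp: variable_def)
  ultimately show ?thesis by (simp add: Idl_squarefree)
qed

section \<open>From free resolutions to the projective dimension\<close>

text \<open>
  The free module of rank \<open>r\<close> on the coordinate type that is prescribed by the definition of the
  projective dimension; only the left summand of that type carries coordinates.  Multiplication and
  unit are dummy values for the record fields that a module inherits from rings.
\<close>

definition free_module :: "nat \<Rightarrow> ('a::comm_ring_1, nat + 'm \<Rightarrow> 'a) module" where
  "free_module r =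
     \<lparr>carrier = {f. (\<forall>i\<ge>r. f (Inl i) = 0) \<and> (\<forall>k. f (Inr k) = 0)}, monoid.mult = (\<lambda>_ _. 0), one = 0,
      zero = 0, add = (+), module.smult = vscale\<rparr>"

lemma free_module_simps:
  "carrier (free_module r) = {f. (\<forall>i\<ge>r. f (Inl i) = 0) \<and> (\<forall>k. f (Inr k) = 0)}"
  "f \<oplus>\<^bsub>free_module r\<^esub> g = f + g" "\<zero>\<^bsub>free_module r\<^esub> = 0"
  "a \<odot>\<^bsub>free_module r\<^esub> f = vscale a f"
  by (simp_all add: free_module_def)

definition extend_coords :: "(nat \<Rightarrow> 'a::zero) \<Rightarrow> nat + 'm \<Rightarrow> 'a" where
  "extend_coords c = case_sum c (\<lambda>_. 0)"

lemma carrier_free_module: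
  "carrier (free_module r :: ('a::comm_ring_1, nat + 'm \<Rightarrow> 'a) module) = extend_coords ` {c. \<forall>i\<ge>r. c i = 0}"
proof (intro Set.set_eqI iffI)
  fix f :: "nat + 'm \<Rightarrow> 'a" assume f: "f \<in> carrier (free_module r)"
  then have "f = extend_coords (\<lambda>i. f (Inl i))"
    by (auto simp: fun_eq_iff extend_coords_def free_module_simps split: sum.split)
  moreover have "\<forall>i\<ge>r. f (Inl i) = 0" using f by (auto simp: free_module_simps)
  ultimately show "f \<in> extend_coords ` {c. \<forall>i\<ge>r. c i = 0}" by blast
qed (auto simp: free_module_simps extend_coords_def)

lemma module_free_module:
  "module ring_of_type_algebra (free_module r :: ('a::comm_ring_1, nat + 'm \<Rightarrow> 'a) module)"
proof (rule moduleI)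
  show "cring (ring_of_type_algebra :: 'a ring)" by (rule cring_from_type_algebra)
  show "abelian_group (free_module r :: ('a, nat + 'm \<Rightarrow> 'a) module)"
  proof (rule abelian_groupI)
    fix f :: "nat + 'm \<Rightarrow> 'a" assume "f \<in> carrier (free_module r)"
    then show "\<exists>g\<in>carrier (free_module r). g \<oplus>\<^bsub>free_module r\<^esub> f = \<zero>\<^bsub>free_module r\<^esub>"
      by (intro bexI[of _ "- f"]) (auto simp: free_module_simps)
  qed (auto simp: free_module_simps zero_fun_apply algebra_simps)
qed (auto simp: free_module_simps vscale_apply fun_eq_iff algebra_simps)

lemma mod_homD:
  assumes "f \<in> mod_hom R M N"
  shows "x \<in> carrier M \<Longrightarrow> f x \<in> carrier N"
    and "x \<in> carrier M \<Longrightarrow> y \<in> carrier M \<Longrightarrow> f (x \<oplus>\<^bsub>M\<^esub> y) = f x \<oplus>\<^bsub>N\<^esub> f y"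
    and "a \<in> carrier R \<Longrightarrow> x \<in> carrier M \<Longrightarrow> f (a \<odot>\<^bsub>M\<^esub> x) = a \<odot>\<^bsub>N\<^esub> f x"
  using assms by (auto simp: mod_hom_def)

lemma mod_hom_zero:
  assumes "module R M" "module R N" "f \<in> mod_hom R M N"
  shows "f \<zero>\<^bsub>M\<^esub> = \<zero>\<^bsub>N\<^esub>"
proof -
  interpret M: Module.module R M by fact
  interpret N: Module.module R N by fact
  have "f (\<zero>\<^bsub>R\<^esub> \<odot>\<^bsub>M\<^esub> \<zero>\<^bsub>M\<^esub>) = \<zero>\<^bsub>R\<^esub> \<odot>\<^bsub>N\<^esub> f \<zero>\<^bsub>M\<^esub>"
    by (rule mod_homD(3)[OF assms(3)]) auto
  then show ?thesis using mod_homD(1)[OF assms(3)] by simp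
qed

text \<open>
  Induction on the rank: a lift on the first \<open>r\<close> coordinates is extended by sending the last basis
  vector to any preimage of its image.
\<close>

lemma free_module_lift:
  assumes N: "module ring_of_type_algebra N" and Q: "module ring_of_type_algebra Q"
    and g: "g \<in> mod_hom ring_of_type_algebra N Q" and surj: "g ` carrier N = carrier Q"
    and f: "f \<in> mod_hom ring_of_type_algebra (free_module r :: ('a::comm_ring_1, nat + 'm \<Rightarrow> 'a) module) Q"
  shows "\<exists>h\<in>mod_hom ring_of_type_algebra (free_module r :: ('a, nat + 'm \<Rightarrow> 'a) module) N.
           \<forall>x\<in>carrier (free_module r). g (h x) = f x"
  using f
proof (induction r)
  interpret N: Module.module ring_of_type_algebra N by fact
  interpret Q: Module.module ring_of_type_algebra Q by fact
  case 0
  have zero: "carrier (free_module 0 :: ('a, nat + 'm \<Rightarrow> 'a) module) = {0}"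
    by (auto simp: free_module_simps fun_eq_iff split_sum_all zero_fun_apply)
  have "(\<lambda>_. \<zero>\<^bsub>N\<^esub>) \<in> mod_hom ring_of_type_algebra (free_module 0 :: ('a, nat + 'm \<Rightarrow> 'a) module) N"
    by (simp add: mod_hom_def)
  moreover have "g \<zero>\<^bsub>N\<^esub> = f 0"
    using mod_hom_zero[OF N Q g] mod_hom_zero[OF module_free_module Q 0]
    by (simp add: free_module_simps)
  ultimately show ?case unfolding zero by (intro bexI[of _ "\<lambda>_. \<zero>\<^bsub>N\<^esub>"]) simp_all
next
  interpret N: Module.module ring_of_type_algebra N by fact
  interpret Q: Module.module ring_of_type_algebra Q by fact
  case (Suc r)
  let ?F = "\<lambda>r. free_module r :: ('a, nat + 'm \<Rightarrow> 'a) module"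
  let ?e = "(\<lambda>j. if j = Inl r then 1 else 0) :: nat + 'm \<Rightarrow> 'a"
  define t where "t x = (\<lambda>j. if j = Inl r then 0 else x j)" for x :: "nat + 'm \<Rightarrow> 'a"
  have sub: "carrier (?F r) \<subseteq> carrier (?F (Suc r))" by (auto simp: free_module_simps)
  have t: "t x \<in> carrier (?F r)" if "x \<in> carrier (?F (Suc r))" for x
    using that by (auto simp: free_module_simps t_def Suc_le_eq)
  have e: "?e \<in> carrier (?F (Suc r))" by (auto simp: free_module_simps)
  have split: "x = t x + vscale (x (Inl r)) ?e" for x
    by (auto simp: t_def fun_eq_iff vscale_apply)
  have "f \<in> mod_hom ring_of_type_algebra (?F r) Q"
    using Suc.prems sub by (auto simp: mod_hom_def free_module_simps Pi_iff subset_iff)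
  then obtain h where h: "h \<in> mod_hom ring_of_type_algebra (?F r) N"
    and gh: "\<And>x. x \<in> carrier (?F r) \<Longrightarrow> g (h x) = f x"
    using Suc.IH by blast
  have "f ?e \<in> g ` carrier N" unfolding surj by (rule mod_homD(1)[OF Suc.prems e])
  then obtain n where n: "n \<in> carrier N" "g n = f ?e" by auto
  define h' where "h' x = h (t x) \<oplus>\<^bsub>N\<^esub> x (Inl r) \<odot>\<^bsub>N\<^esub> n" for x
  have ht: "h (t x) \<in> carrier N" if "x \<in> carrier (?F (Suc r))" for x
    using mod_homD(1)[OF h t[OF that]] .
  have t_add: "t (x + y) = t x + t y" for x y by (auto simp: t_def fun_eq_iff)
  have t_scale: "t (vscale a x) = vscale a (t x)" for a x
    by (auto simp: t_def fun_eq_iff vscale_apply)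
  have "h' \<in> mod_hom ring_of_type_algebra (?F (Suc r)) N"
    unfolding mod_hom_def
  proof (intro CollectI conjI ballI Pi_I)
    fix x assume x: "x \<in> carrier (?F (Suc r))"
    then show "h' x \<in> carrier N" using ht n by (simp add: h'_def)
    fix y assume y: "y \<in> carrier (?F (Suc r))"
    have "h (t (x + y)) = h (t x) \<oplus>\<^bsub>N\<^esub> h (t y)"
      using mod_homD(2)[OF h t[OF x] t[OF y]] by (simp add: t_add free_module_simps)
    moreover have "(x + y) (Inl r) \<odot>\<^bsub>N\<^esub> n = x (Inl r) \<odot>\<^bsub>N\<^esub> n \<oplus>\<^bsub>N\<^esub> y (Inl r) \<odot>\<^bsub>N\<^esub> n"
      using N.smult_l_distr[of "x (Inl r)" "y (Inl r)" n] n by simp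
    ultimately show "h' (x \<oplus>\<^bsub>?F (Suc r)\<^esub> y) = h' x \<oplus>\<^bsub>N\<^esub> h' y"
      using ht[OF x] ht[OF y] n by (simp add: h'_def free_module_simps N.M.a_ac)
  next
    fix a :: 'a and x assume x: "x \<in> carrier (?F (Suc r))"
    have "h (t (vscale a x)) = a \<odot>\<^bsub>N\<^esub> h (t x)"
      using mod_homD(3)[OF h _ t[OF x], of a] by (simp add: t_scale free_module_simps)
    moreover have "vscale a x (Inl r) \<odot>\<^bsub>N\<^esub> n = a \<odot>\<^bsub>N\<^esub> (x (Inl r) \<odot>\<^bsub>N\<^esub> n)"
      using N.smult_assoc1[of a "x (Inl r)" n] n by (simp add: vscale_apply)
    ultimately show "h' (a \<odot>\<^bsub>?F (Suc r)\<^esub> x) = a \<odot>\<^bsub>N\<^esub> h' x"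
      using ht[OF x] n N.smult_r_distr[of a "h (t x)" "x (Inl r) \<odot>\<^bsub>N\<^esub> n"]
      by (simp add: h'_def free_module_simps)
  qed
  moreover have "g (h' x) = f x" if x: "x \<in> carrier (?F (Suc r))" for x
  proof -
    have "g (h' x) = f (t x) \<oplus>\<^bsub>Q\<^esub> x (Inl r) \<odot>\<^bsub>Q\<^esub> f ?e"
      using mod_homD(2,3)[OF g] ht[OF x] n gh[OF t[OF x]] by (simp add: h'_def)
    also have "\<dots> = f (t x) \<oplus>\<^bsub>Q\<^esub> f (vscale (x (Inl r)) ?e)"
      using mod_homD(3)[OF Suc.prems _ e, of "x (Inl r)"] by (simp add: free_module_simps)
    also have "\<dots> = f (t x + vscale (x (Inl r)) ?e)"
    proof -
      have "t x \<in> carrier (?F (Suc r))" using t[OF x] sub by blast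
      moreover have "vscale (x (Inl r)) ?e \<in> carrier (?F (Suc r))"
        using e by (auto simp: free_module_simps vscale_apply)
      ultimately show ?thesis using mod_homD(2)[OF Suc.prems] by (metis free_module_simps(2))
    qed
    finally show ?thesis using split[of x] by simp
  qed
  ultimately show ?case by blast
qed

lemma projective_free_module:
  "projective_module ring_of_type_algebra (free_module r :: ('a::comm_ring_1, nat + 'm \<Rightarrow> 'a) module)"
  unfolding projective_module_def using module_free_module free_module_lift by blast

text \<open>
  The bridge from matrices to complexes.  The module \<open>P i\<close> has rank \<open>r i\<close> and the differential
  \<open>P (i + 1) \<rightarrow> P i\<close> has matrix \<open>v (i + 1)\<close>, while the map out of \<open>P 0\<close> is the
  augmentation \<open>e\<close>.  Every kernel is then the syzygy module of a matrix.
\<close>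

lemma projective_dimension_le:
  fixes N :: "('a::comm_ring_1, 'm, 's) module_scheme"
    and e :: "(nat + 'm \<Rightarrow> 'a) \<Rightarrow> 'm"
  assumes e: "e \<in> mod_hom ring_of_type_algebra (free_module (r 0)) N"
    and surj: "e ` carrier (free_module (r 0)) = carrier N"
    and ker: "{c. (\<forall>i\<ge>r 0. c i = 0) \<and> e (extend_coords c) = \<zero>\<^bsub>N\<^esub>} = range (lincomb (r 1) (v 1))"
    and exact: "\<And>i. i \<ge> 1 \<Longrightarrow> syz (r i) (v i) = range (lincomb (r (Suc i)) (v (Suc i)))"
    and len: "\<And>i. i > l \<Longrightarrow> r i = 0"
  shows "projective_dimension ring_of_type_algebra N \<le> enat l"
proof -
  define P :: "nat \<Rightarrow> ('a, nat + 'm \<Rightarrow> 'a) module" where "P i = free_module (r i)" for i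
  define d :: "nat \<Rightarrow> (nat + 'm \<Rightarrow> 'a) \<Rightarrow> nat + 'm \<Rightarrow> 'a" where
    "d i f = extend_coords (lincomb (r (Suc i)) (v (Suc i)) (\<lambda>j. f (Inl j)))" for i f
  have ext0: "extend_coords c = 0 \<longleftrightarrow> c = 0" for c :: "nat \<Rightarrow> 'a"
    by (auto simp: extend_coords_def fun_eq_iff zero_fun_apply split: sum.split)
  have d_ext: "d i (extend_coords c) = extend_coords (lincomb (r (Suc i)) (v (Suc i)) c)" for i c
    by (simp add: d_def extend_coords_def)
  have image: "d i ` carrier (P (Suc i)) = extend_coords ` range (lincomb (r (Suc i)) (v (Suc i)))" for i
    unfolding P_def carrier_free_module image_image d_ext
    by (auto simp: image_iff) (metis lincomb_truncated)
  have kernel: "a_kernel (P (Suc i)) (P i) (d i) = extend_coords ` syz (r (Suc i)) (v (Suc i))" for i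
    unfolding a_kernel_def' P_def carrier_free_module
    by (auto simp: free_module_simps d_ext ext0 syz_def)
  \<comment> \<open>The differentials land in the vectors of the right support because their images are kernels.\<close>
  have supp: "range (lincomb (r (Suc i)) (v (Suc i))) \<subseteq> {c. \<forall>j\<ge>r i. c j = 0}" for i
    using ker exact[of i] by (cases i) (auto simp: syz_def)
  have "projective_resolution ring_of_type_algebra N P d e"
    unfolding projective_resolution_def
  proof (intro conjI allI)
    show "projective_module ring_of_type_algebra (P i)" for i
      unfolding P_def by (rule projective_free_module)
    show "e \<in> mod_hom ring_of_type_algebra (P 0) N" "e ` carrier (P 0) = carrier N"
      unfolding P_def by (fact e surj)+
    show "d i \<in> mod_hom ring_of_type_algebra (P (Suc i)) (P i)" for i
    proof -
      interpret L: module_hom vscale vscale "lincomb (r (Suc i)) (v (Suc i))"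
        by (rule linear_lincomb)
      have "d i f \<in> carrier (P i)" if "f \<in> carrier (P (Suc i))" for f
        using image[of i] that supp[of i] unfolding P_def carrier_free_module by blast
      moreover have "d i (f + g) = d i f + d i g" for f g
      proof -
        have "(\<lambda>j. (f + g) (Inl j)) = (\<lambda>j. f (Inl j)) + (\<lambda>j. g (Inl j))" by (simp add: fun_eq_iff)
        then have "d i (f + g) = extend_coords (lincomb (r (Suc i)) (v (Suc i)) (\<lambda>j. f (Inl j)) +
            lincomb (r (Suc i)) (v (Suc i)) (\<lambda>j. g (Inl j)))"
          by (simp only: d_def L.add)
        then show ?thesis
          by (auto simp: d_def extend_coords_def fun_eq_iff split: sum.split)
      qed
      moreover have "d i (vscale a f) = vscale a (d i f)" for a f
      proof -
        have "(\<lambda>j. vscale a f (Inl j)) = vscale a (\<lambda>j. f (Inl j))"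
          by (simp add: fun_eq_iff vscale_apply)
        then have "d i (vscale a f) = extend_coords (vscale a
            (lincomb (r (Suc i)) (v (Suc i)) (\<lambda>j. f (Inl j))))"
          by (simp only: d_def L.scale)
        then show ?thesis
          by (auto simp: d_def extend_coords_def fun_eq_iff vscale_apply split: sum.split)
      qed
      ultimately show ?thesis by (auto simp: mod_hom_def P_def free_module_simps)
    qed
    show "d 0 ` carrier (P 1) = a_kernel (P 0) N e"
    proof -
      have "a_kernel (P 0) N e =
          extend_coords ` {c. (\<forall>i\<ge>r 0. c i = 0) \<and> e (extend_coords c) = \<zero>\<^bsub>N\<^esub>}"
        unfolding a_kernel_def' P_def carrier_free_module by blast
      then show ?thesis using image[of 0] unfolding ker by simp
    qed
    show "d (Suc i) ` carrier (P (Suc (Suc i))) = a_kernel (P (Suc i)) (P i) (d i)" for i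
      unfolding image kernel using exact[of "Suc i"] by simp
  qed
  moreover have "\<forall>i>l. carrier (P i) = {\<zero>\<^bsub>P i\<^esub>}"
    using len by (auto simp: P_def free_module_simps fun_eq_iff split_sum_all zero_fun_apply)
  ultimately show ?thesis unfolding projective_dimension_def by (intro Inf_lower) blast
qed

lemma quotient_module_simps:
  fixes I :: "'a::comm_ring_1 set"
  shows "carrier (quotient_module ring_of_type_algebra I) = range (\<lambda>p. I +>\<^bsub>ring_of_type_algebra\<^esub> p)"
    and "\<zero>\<^bsub>quotient_module ring_of_type_algebra I\<^esub> = I"
    and "A \<oplus>\<^bsub>quotient_module ring_of_type_algebra I\<^esub> B = set_add ring_of_type_algebra A B"
    and "a \<odot>\<^bsub>quotient_module ring_of_type_algebra I\<^esub> Y =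
      rcoset_mult ring_of_type_algebra I (I +>\<^bsub>ring_of_type_algebra\<^esub> a) Y"
  by (auto simp: quotient_module_def ring.extend_def module.fields_def FactRing_def A_RCOSETS_def'
      image_def)

text \<open>
  A resolution of \<open>I\<close> by \<open>l\<close> free modules is continued by \<open>R \<rightarrow> R/I\<close>, which puts them in degrees
  \<open>1, \<dots>, l\<close>.
\<close>

lemma projective_dimension_quotient_le:
  fixes I :: "'a::comm_ring_1 set"
  assumes I: "ideal I ring_of_type_algebra" and res: "has_free_res l (embed_ideal I)"
  shows "projective_dimension ring_of_type_algebra (quotient_module ring_of_type_algebra I) \<le> enat l"
proof -
  interpret I: ideal I ring_of_type_algebra by fact
  obtain r v where rv: "embed_ideal I = range (lincomb (r 0) (v 0))"
    "\<And>i. syz (r i) (v i) = range (lincomb (r (Suc i)) (v (Suc i)))" "\<And>i. i \<ge> l \<Longrightarrow> r i = 0"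
    using has_free_res_sequence[OF res] by blast
  define e :: "(nat + 'a set \<Rightarrow> 'a) \<Rightarrow> 'a set" where
    "e f = I +>\<^bsub>ring_of_type_algebra\<^esub> f (Inl 0)" for f
  show ?thesis
  proof (rule projective_dimension_le[where e = e and r = "case_nat 1 r" and v = "case_nat (\<lambda>_. 0) v"])
    show "e \<in> mod_hom ring_of_type_algebra (free_module (case_nat 1 r 0))
        (quotient_module ring_of_type_algebra I)"
      using I.rcoset_mult_add I.a_rcos_sum
      by (auto simp: mod_hom_def quotient_module_simps e_def free_module_simps vscale_apply)
    show "e ` carrier (free_module (case_nat 1 r 0)) =
        carrier (quotient_module ring_of_type_algebra I)"
    proof -
      have "I +>\<^bsub>ring_of_type_algebra\<^esub> p \<in> e ` carrier (free_module 1)" for p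
        by (rule image_eqI[of _ _ "\<lambda>j. if j = Inl 0 then p else 0"])
           (auto simp: e_def free_module_simps)
      then show ?thesis by (auto simp: quotient_module_simps e_def)
    qed
    have "I +>\<^bsub>ring_of_type_algebra\<^esub> p = I \<longleftrightarrow> p \<in> I" for p
      using I.a_rcos_self[of p] I.a_coset_join2[of p I] I.additive_subgroup_axioms
      by (auto simp: I.a_rcos_const)
    then have "{c. (\<forall>i\<ge>case_nat 1 r 0. c i = 0) \<and>
        e (extend_coords c) = \<zero>\<^bsub>quotient_module ring_of_type_algebra I\<^esub>} = embed_ideal I"
      by (auto simp: quotient_module_simps e_def extend_coords_def embed_ideal_def Suc_le_eq)
    then show "{c. (\<forall>i\<ge>case_nat 1 r 0. c i = 0) \<and>
          e (extend_coords c) = \<zero>\<^bsub>quotient_module ring_of_type_algebra I\<^esub>} =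
        range (lincomb (case_nat 1 r 1) (case_nat (\<lambda>_. 0) v 1))"
      using rv(1) by simp
    show "syz (case_nat 1 r i) (case_nat (\<lambda>_. 0) v i) =
        range (lincomb (case_nat 1 r (Suc i)) (case_nat (\<lambda>_. 0) v (Suc i)))" if "i \<ge> 1" for i
      using that rv(2) by (cases i) auto
    show "case_nat 1 r i = 0" if "i > l" for i
      using that rv(3) by (cases i) auto
  qed
qed

text \<open>
  For the unit ideal, \<open>R \<rightarrow> R/I\<close> is not the beginning of a shortest resolution: the zero complex
  resolves \<open>R/R = 0\<close>.
\<close>

lemma projective_dimension_quotient_unit_ideal:
  "projective_dimension ring_of_type_algebra
     (quotient_module ring_of_type_algebra (UNIV :: 'a::comm_ring_1 set)) \<le> 0"
proof -
  interpret I: ideal "UNIV :: 'a set" ring_of_type_algebra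
    by (rule ideal_ring_of_type_algebraI) auto
  have coset: "UNIV +>\<^bsub>ring_of_type_algebra\<^esub> p = (UNIV :: 'a set)" for p :: 'a
    by (rule I.a_rcos_const) simp
  have 0: "carrier (free_module 0 :: ('a, nat + 'a set \<Rightarrow> 'a) module) = {0}"
    by (auto simp: free_module_simps fun_eq_iff split_sum_all zero_fun_apply)
  have "projective_dimension ring_of_type_algebra
      (quotient_module ring_of_type_algebra (UNIV :: 'a set)) \<le> enat 0"
  proof (rule projective_dimension_le[where e = "\<lambda>_. UNIV" and r = "\<lambda>_. 0" and v = "\<lambda>_ _. 0"])
    show "(\<lambda>_. UNIV) \<in> mod_hom ring_of_type_algebra (free_module 0)
        (quotient_module ring_of_type_algebra (UNIV :: 'a set))"
      using I.rcoset_mult_add I.a_rcos_sum by (simp add: mod_hom_def quotient_module_simps coset)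
    show "{c. (\<forall>i\<ge>0. c i = 0) \<and> UNIV = \<zero>\<^bsub>quotient_module ring_of_type_algebra (UNIV :: 'a set)\<^esub>}
        = range (lincomb 0 (\<lambda>_. 0 :: nat \<Rightarrow> 'a))"
      by (auto simp: quotient_module_simps fun_eq_iff zero_fun_apply)
  qed (auto simp: 0 quotient_module_simps coset)
  then show ?thesis by (simp add: zero_enat_def)
qed

section \<open>Projective dimension equal to the number of variables\<close>

theorem theorem3p1:
  fixes M :: "('n::finite, 'k::field) mpoly set"
  assumes "squarefree_monomial_ideal M"
    and "projective_dimension mpoly_ring (quotient_module mpoly_ring M) = enat CARD('n)"
  shows "M = Idl\<^bsub>mpoly_ring\<^esub> (range variable)"
proof -
  obtain G where G: "G \<subseteq> squarefree_monomials" "M = Idl\<^bsub>mpoly_ring\<^esub> G"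
    using assms(1) unfolding squarefree_monomial_ideal_def by blast
  define \<Gamma> where
    "\<Gamma> = {T. \<exists>m. (monomial m :: ('n, 'k) mpoly) \<in> G \<and> Poly_Mapping.keys m \<subseteq> T}"
  have M: "M = support_ideal \<Gamma>" using Idl_squarefree[OF G(1)] G(2) by (simp add: \<Gamma>_def)
  have up: "up_closed \<Gamma>" unfolding \<Gamma>_def by blast
  have pos: "0 < CARD('n)" by simp
  have proper: "{} \<notin> \<Gamma>"
  proof
    assume "{} \<in> \<Gamma>"
    then have "T \<in> \<Gamma>" for T using up by (meson empty_subsetI)
    then have "M = UNIV" by (simp add: M support_ideal_def)
    then have "enat CARD('n) \<le> 0"
      using projective_dimension_quotient_unit_ideal assms(2) by metis
    with pos show False by (simp add: zero_enat_def)
  qed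
  have "\<Gamma> = {T. T \<noteq> {}}"
  proof (rule ccontr)
    assume "\<Gamma> \<noteq> {T. T \<noteq> {}}"
    then have "has_free_res (CARD('n) - 1) (embed_ideal M)"
      using has_free_res_support_ideal[of UNIV \<Gamma>, where 'k = 'k] up proper by (simp add: M)
    moreover have "ideal M mpoly_ring"
      unfolding M by (intro ideal_ring_of_type_algebraI support_ideal_zero support_ideal_add
          support_ideal_mult[OF up])
    ultimately have "enat CARD('n) \<le> enat (CARD('n) - 1)"
      using projective_dimension_quotient_le assms(2) by metis
    then have "CARD('n) \<le> CARD('n) - 1" by (simp only: enat_ord_simps)
    with pos show False by linarith
  qed
  then show ?thesis by (simp add: M Idl_variables)
qed

end
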